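(* Let $\lambda_1,\lambda_2>0$ and $\vec\lambda=(\lambda_1,\lambda_2)$. For $\beta\in(0,1]$, $$\int_{\mathbb{R}^2}C_1^\beta(x_1)\,C_2^\beta(x_2)\,\mathrm{d}\pi^2_{\vec\lambda,\beta}(x_1,x_2)=0\quad\text{if and only if}\quad\beta=1.$$ Here $C_1^\beta(x_1)$ is formed with rate $\lambda_1$ and $C_2^\beta(x_2)$ with rate $\lambda_2$, as defined in the context.
   Context: $E_\beta(z)=\sum_{n\ge0}z^n/\Gamma(\beta n+1)$ is the Mittag-Leffler function. For $\lambda>0$, the fractional Poisson measure $\pi_{\lambda,\beta}$ on $\mathbb{N}_0$ (viewed on $\mathbb{R}$) is $\pi_{\lambda,\beta}(\{k\})=\frac{\lambda^k}{k!}E_\beta^{(k)}(-\lambda)$, $k\in\mathbb{N}_0$, with moments $m_{\lambda,\beta}(n)=\int x^n\,d\pi_{\lambda,\beta}(x)$. The two-dimensional measure $\pi^2_{\vec\lambda,\beta}$ on $\mathbb{N}_0^2\subset\mathbb{R}^2$ is the probability measure with Laplace transform $\int_{\mathbb{R}^2}e^{x_1s_1+x_2s_2}\,d\pi^2_{\vec\lambda,\beta}(x)=E_\beta\big(\lambda_1(e^{s_1}-1)+\lambda_2(e^{s_2}-1)\big)$, $s=(s_1,s_2)\in\mathbb{R}^2$. For rate $\lambda$, $C_n^\beta$ are the monic polynomials obtained by Gram-Schmidt orthogonalization of the monomials $x^n$ with respect to the inner product $(p,q)=\int pq\,d\pi_{\lambda,\beta}$. In particular $C_1^\beta(x)=x-m_{\lambda,\beta}(1)$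 and $C_2^\beta(x)=x^2-A(\beta,\lambda)x-m_{\lambda,\beta}(2)+A(\beta,\lambda)m_{\lambda,\beta}(1)$, with $A(\beta,\lambda)=\frac{m_{\lambda,\beta}(3)-m_{\lambda,\beta}(1)m_{\lambda,\beta}(2)}{m_{\lambda,\beta}(2)-m_{\lambda,\beta}(1)^2}$. *)

theory Defs
  imports "HOL-Probability.Probability"
begin

definition mittag_leffler :: "real \<Rightarrow> real \<Rightarrow> real" where
  "mittag_leffler \<beta> z = (\<Sum>n. z ^ n / Gamma (\<beta> * real n + 1))"

(* The weights are nonnegative for 0 < \<beta> \<le> 1 and lam > 0 (complete monotonicity of
   x \<mapsto> mittag_leffler \<beta> (- x)), so ennreal does not truncate there. *)
definition fractional_poisson :: "real \<Rightarrow> real \<Rightarrow> real measure" where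
  "fractional_poisson \<beta> lam =
     distr (point_measure (UNIV :: nat set)
              (\<lambda>k. ennreal (lam ^ k / fact k * (deriv ^^ k) (mittag_leffler \<beta>) (- lam))))
           borel real"

(* The Laplace transform determines the measure, so for given parameters at most one P
   satisfies this predicate. *)
definition is_fractional_poisson2 ::
    "real \<Rightarrow> real \<Rightarrow> real \<Rightarrow> (real \<times> real) measure \<Rightarrow> bool" where
  "is_fractional_poisson2 \<beta> lam1 lam2 P \<longleftrightarrow>
     prob_space P \<and> sets P = sets borel \<and> (AE x in P. x \<in> \<nat> \<times> \<nat>) \<and>
     (\<forall>s1 s2. has_bochner_integral P (\<lambda>(x1, x2). exp (x1 * s1 + x2 * s2))
        (mittag_leffler \<beta> (lam1 * (exp s1 - 1) + lam2 * (exp s2 - 1))))"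

definition fp_inner :: "real \<Rightarrow> real \<Rightarrow> real poly \<Rightarrow> real poly \<Rightarrow> real" where
  "fp_inner \<beta> lam p q = (\<integral>x. poly p x * poly q x \<partial>fractional_poisson \<beta> lam)"

context
  notes sum.cong [fundef_cong]
begin

fun gram_schmidt_poly :: "real \<Rightarrow> real \<Rightarrow> nat \<Rightarrow> real poly" where
  "gram_schmidt_poly \<beta> lam n =
     monom 1 n - (\<Sum>k<n. smult
       (fp_inner \<beta> lam (monom 1 n) (gram_schmidt_poly \<beta> lam k) /
        fp_inner \<beta> lam (gram_schmidt_poly \<beta> lam k) (gram_schmidt_poly \<beta> lam k))
       (gram_schmidt_poly \<beta> lam k))"

end

declare gram_schmidt_poly.simps [simp del]

end

theory Submission imports Defs begin

text \<open>
  The Laplace transform says that \<open>P\<close> is a mixed Poisson law: conditionally on a random variable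
  \<open>T \<ge> 0\<close> with moments \<open>a\<^sub>n = n! / \<Gamma>(\<beta>n + 1)\<close>, the coordinates are independent Poisson variables
  with rates \<open>\<lambda>\<^sub>1 T\<close> and \<open>\<lambda>\<^sub>2 T\<close>. This picture enters through its moments. Writing
  \<open>exp s\<^sub>i = 1 + u\<^sub>i\<close> turns the Laplace transform into \<open>E\<^sub>\<beta>(\<lambda>\<^sub>1 u\<^sub>1 + \<lambda>\<^sub>2 u\<^sub>2)\<close>, the generating
  function of the factorial moments, so comparing coefficients yields
  \<open>E[(x\<^sub>1)\<^sub>i (x\<^sub>2)\<^sub>j] = \<lambda>\<^sub>1\<^sup>i \<lambda>\<^sub>2\<^sup>j a\<^bsub>i+j\<^esub>\<close> for falling factorials
  (\<open>fp2_factorial_moment\<close>). The same transform with one \<open>s\<^sub>i = 0\<close> is a probability generating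
  function, and its Taylor coefficients identify the marginals of \<open>P\<close> with the one-dimensional
  measures (\<open>distr_eq_fractional_poisson\<close>), so the Gram-Schmidt coefficients are also rational
  expressions in \<open>\<lambda>\<^sub>2\<close>, \<open>a\<^sub>1\<close>, \<open>a\<^sub>2\<close>, \<open>a\<^sub>3\<close>.

  Multiplying the integral in question by the variance \<open>\<lambda>\<^sub>2\<^sup>2(a\<^sub>2 - a\<^sub>1\<^sup>2) + \<lambda>\<^sub>2 a\<^sub>1\<close> of \<open>x\<^sub>2\<close>, which
  is positive, makes almost everything cancel (\<open>covariance_algebra\<close>) and leaves
  \<open>\<lambda>\<^sub>1 \<lambda>\<^sub>2\<^sup>3 (a\<^sub>1 a\<^sub>3 + a\<^sub>1\<^sup>2 a\<^sub>2 - 2 a\<^sub>2\<^sup>2)\<close>. For \<open>\<beta> = 1\<close> all \<open>a\<^sub>n\<close> equal \<open>1\<close> and this vanishes.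

  For \<open>\<beta> < 1\<close> the bracket is negative. Expressed through Beta functions, this says
  \<open>B(\<beta>, \<beta>) - B(\<beta>, 2\<beta>) > 1/(2\<beta>)\<close>. The right-hand side is \<open>B(1, \<beta>) - B(1, 2\<beta>)\<close>, and the
  difference of the two sides is the integral over \<open>0 < t < 1\<close> of
  \<open>(t\<^bsup>\<beta>-1\<^esup> - 1) ((1 - t)\<^bsup>\<beta>-1\<^esup> - (1 - t)\<^bsup>2\<beta>-1\<^esup>)\<close>, whose factors are both positive
  (\<open>Beta_diff_gt\<close>).
\<close>

section \<open>Everywhere convergent power series\<close>

lemma summable_powser_everywhere:
  fixes c :: "nat \<Rightarrow> real"
  assumes "\<And>x. 0 < x \<Longrightarrow> summable (\<lambda>n. c n * x ^ n)"
  shows "summable (\<lambda>n. c n * z ^ n)"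
  by (rule powser_inside[where x = "\<bar>z\<bar> + 1"]) (use assms in auto)

lemma summable_diffs_iter:
  fixes c :: "nat \<Rightarrow> real"
  assumes "\<And>z. summable (\<lambda>n. c n * z ^ n)"
  shows "summable (\<lambda>n. (diffs ^^ k) c n * z ^ n)"
proof (induction k arbitrary: z)
  case (Suc k)
  then show ?case using termdiff_converges_all[of "(diffs ^^ k) c"] by simp
qed (use assms in simp)

lemma powser_diffs_iter_deriv:
  fixes c :: "nat \<Rightarrow> real"
  assumes "\<And>z. summable (\<lambda>n. c n * z ^ n)"
  shows "((\<lambda>z. \<Sum>n. (diffs ^^ k) c n * z ^ n) has_field_derivative
            (\<Sum>n. (diffs ^^ Suc k) c n * z ^ n)) (at z)"
  using termdiffs_strong_converges_everywhere[OF summable_diffs_iter[OF assms]] by simp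

lemma higher_deriv_powser:
  fixes c :: "nat \<Rightarrow> real"
  assumes "\<And>z. summable (\<lambda>n. c n * z ^ n)"
  shows "(deriv ^^ k) (\<lambda>z. \<Sum>n. c n * z ^ n) = (\<lambda>z. \<Sum>n. (diffs ^^ k) c n * z ^ n)"
proof (induction k)
  case (Suc k)
  show ?case
    by (simp only: funpow.simps o_apply Suc fun_eq_iff)
       (use DERIV_imp_deriv[OF powser_diffs_iter_deriv[OF assms, of k]] in simp)
qed simp

lemma diffs_iter_0:
  fixes c :: "nat \<Rightarrow> real"
  shows "(diffs ^^ k) c 0 = fact k * c k"
proof (induction k arbitrary: c)
  case (Suc k)
  have "(diffs ^^ Suc k) c 0 = (diffs ^^ k) (diffs c) 0"
    by (simp add: funpow_swap1)
  also have "\<dots> = fact (Suc k) * c (Suc k)"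
    by (subst Suc) (simp add: diffs_def algebra_simps)
  finally show ?case .
qed simp

text \<open>
  Both sides are smooth on the whole line, so differentiating \<open>k\<close> times on the open half-line and
  letting \<open>u \<rightarrow> 0\<close> from the right compares the derivatives at \<open>0\<close>. A half-line is
  all that is available because \<open>u\<close> will be of the form \<open>exp s\<close>.
\<close>

lemma powser_affine_transfer:
  fixes a b :: "nat \<Rightarrow> real" and \<alpha> \<gamma> :: real
  assumes a: "\<And>z. summable (\<lambda>n. a n * z ^ n)" and b: "\<And>z. summable (\<lambda>n. b n * z ^ n)"
    and eq: "\<And>u. 0 < u \<Longrightarrow> (\<Sum>n. a n * u ^ n) = (\<Sum>n. b n * (\<alpha> * u + \<gamma>) ^ n)"
  shows "fact k * a k = \<alpha> ^ k * (\<Sum>n. (diffs ^^ k) b n * \<gamma> ^ n)"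
proof -
  define F where "F j u = (\<Sum>n. (diffs ^^ j) a n * u ^ n)" for j and u :: real
  define G where "G j z = (\<Sum>n. (diffs ^^ j) b n * z ^ n)" for j and z :: real
  have dF: "(F j has_field_derivative F (Suc j) u) (at u)" for j u
    using powser_diffs_iter_deriv[OF a] unfolding F_def .
  have dG: "(G j has_field_derivative G (Suc j) u) (at u)" for j u
    using powser_diffs_iter_deriv[OF b] unfolding G_def .
  have dH: "((\<lambda>u. \<alpha> ^ j * G j (\<alpha> * u + \<gamma>)) has_field_derivative
      \<alpha> ^ Suc j * G (Suc j) (\<alpha> * u + \<gamma>)) (at u)" for j u
    by (auto intro!: derivative_eq_intros DERIV_chain2[OF dG])
  have pos: "F j u = \<alpha> ^ j * G j (\<alpha> * u + \<gamma>)" if "0 < u" for j u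
    using that
  proof (induction j arbitrary: u)
    case 0
    then show ?case using eq by (simp add: F_def G_def)
  next
    case (Suc j)
    have "((\<lambda>u. \<alpha> ^ j * G j (\<alpha> * u + \<gamma>)) has_field_derivative F (Suc j) u) (at u)"
      by (rule has_field_derivative_transform_within_open[OF dF, where S = "{0<..}"])
         (use Suc in auto)
    with dH show ?case by (intro DERIV_unique)
  qed
  have contG: "isCont (\<lambda>u. \<alpha> ^ k * G k (\<alpha> * u + \<gamma>)) 0"
    using DERIV_isCont[OF dH] .
  have "(F k \<longlongrightarrow> F k 0) (at_right 0)"
    using DERIV_isCont[OF dF[of k 0]] by (simp add: isCont_def tendsto_within_subset filterlim_at_split)
  moreover have "(F k \<longlongrightarrow> \<alpha> ^ k * G k (\<alpha> * 0 + \<gamma>)) (at_right 0)"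
  proof (rule Lim_transform_eventually)
    show "((\<lambda>u. \<alpha> ^ k * G k (\<alpha> * u + \<gamma>)) \<longlongrightarrow> \<alpha> ^ k * G k (\<alpha> * 0 + \<gamma>)) (at_right 0)"
      using contG by (simp add: isCont_def filterlim_at_split)
    show "eventually (\<lambda>u. \<alpha> ^ k * G k (\<alpha> * u + \<gamma>) = F k u) (at_right 0)"
      using pos by (auto simp: eventually_at_right_field intro!: exI[of _ 1])
  qed
  ultimately have "F k 0 = \<alpha> ^ k * G k (\<alpha> * 0 + \<gamma>)"
    by (rule tendsto_unique[OF trivial_limit_at_right_real])
  then show ?thesis by (simp add: F_def G_def diffs_iter_0)
qed

lemma powser_unique_pos:
  fixes a b :: "nat \<Rightarrow> real"
  assumes a: "\<And>x. 0 < x \<Longrightarrow> (\<lambda>n. a n * x ^ n) sums f x"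
    and b: "\<And>x. 0 < x \<Longrightarrow> (\<lambda>n. b n * x ^ n) sums f x"
  shows "a k = b k"
proof -
  have "fact k * a k = 1 ^ k * (\<Sum>n. (diffs ^^ k) b n * 0 ^ n)"
  proof (rule powser_affine_transfer)
    show "summable (\<lambda>n. a n * z ^ n)" for z
      by (rule summable_powser_everywhere) (rule sums_summable[OF a])
    show "summable (\<lambda>n. b n * z ^ n)" for z
      by (rule summable_powser_everywhere) (rule sums_summable[OF b])
    show "(\<Sum>n. a n * u ^ n) = (\<Sum>n. b n * (1 * u + 0) ^ n)" if "0 < u" for u
      using a[OF that] b[OF that] by (simp add: sums_iff)
  qed
  then show ?thesis by (simp add: diffs_iter_0)
qed

section \<open>The Mittag-Leffler series\<close>

definition ml_coeff :: "real \<Rightarrow> nat \<Rightarrow> real" where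
  "ml_coeff \<beta> n = 1 / Gamma (\<beta> * real n + 1)"

lemma mittag_leffler_powser: "mittag_leffler \<beta> = (\<lambda>z. \<Sum>n. ml_coeff \<beta> n * z ^ n)"
  by (simp add: fun_eq_iff mittag_leffler_def ml_coeff_def)

lemma ml_coeff_pos: "0 < \<beta> \<Longrightarrow> 0 < ml_coeff \<beta> n"
  unfolding ml_coeff_def by (intro divide_pos_pos Gamma_real_pos) (simp_all add: add_nonneg_pos)

text \<open>
  Restrict the integral of \<open>t\<^bsup>x-1\<^esup> e\<^bsup>-t\<^esup>\<close> to \<open>[T, T + 1]\<close> and bound both factors. As \<open>T\<close> is
  free, \<open>\<Gamma>\<close> outgrows every exponential, which is what the convergence of the Mittag-Leffler
  series requires.
\<close>

lemma Gamma_ge_powr: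
  fixes x T :: real
  assumes "1 \<le> x" "0 < T"
  shows "T powr (x - 1) * exp (- (T + 1)) \<le> Gamma x"
proof -
  define f where "f = (\<lambda>t::real. t powr (x - 1) / exp t)"
  have Gam: "(f has_integral Gamma x) {0..}"
    using Gamma_integral_real[of x] assms by (simp add: f_def)
  have "continuous_on {T..T+1} f"
    unfolding f_def using assms by (intro continuous_intros) auto
  then obtain I where I: "(f has_integral I) {T..T+1}"
    using integrable_continuous_real by blast
  have "((\<lambda>t. T powr (x - 1) * exp (- (T + 1))) has_integral T powr (x - 1) * exp (- (T + 1))) {T..T+1}"
    using has_integral_const_real[of "T powr (x - 1) * exp (- (T + 1))" T "T + 1"] by simp
  then have "T powr (x - 1) * exp (- (T + 1)) \<le> I"
  proof (rule has_integral_le[OF _ I])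
    fix t assume t: "t \<in> {T..T+1}"
    have "T powr (x - 1) * exp (- (T + 1)) \<le> t powr (x - 1) * exp (- t)"
      using t assms by (intro mult_mono powr_mono2) auto
    then show "T powr (x - 1) * exp (- (T + 1)) \<le> f t"
      by (simp add: f_def exp_minus field_simps)
  qed
  also have "I \<le> Gamma x"
    using I Gam by (rule has_integral_subset_le[rotated]) (use assms in \<open>auto simp: f_def\<close>)
  finally show ?thesis .
qed

lemma summable_mittag_leffler:
  assumes "0 < \<beta>"
  shows "summable (\<lambda>n. ml_coeff \<beta> n * z ^ n)"
proof (rule summable_powser_everywhere)
  fix x :: real assume x: "0 < x"
  \<comment> \<open>With this choice the coefficients are dominated by a multiple of \<open>(2 x)\<^bsup>-n\<^esup>\<close>.\<close>
  define T where "T = (2 * x) powr (1 / \<beta>)"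
  have T: "0 < T" "T powr \<beta> = 2 * x" using x assms by (auto simp: T_def powr_powr)
  show "summable (\<lambda>n. ml_coeff \<beta> n * x ^ n)"
  proof (rule summable_comparison_test')
    show "summable (\<lambda>n. exp (T + 1) * (1 / 2) ^ n)"
      by (intro summable_mult summable_geometric) simp
    fix n :: nat
    have "T powr (\<beta> * real n) = (2 * x) ^ n"
      using T x by (metis mult.commute powr_powr powr_realpow zero_less_mult_iff zero_less_numeral)
    then have "(2 * x) ^ n * exp (- (T + 1)) \<le> Gamma (\<beta> * real n + 1)"
      using Gamma_ge_powr[of "\<beta> * real n + 1" T] T assms by simp
    moreover have "0 < Gamma (\<beta> * real n + 1)"
      using assms by (intro Gamma_real_pos) (simp add: add_nonneg_pos)
    ultimately have "ml_coeff \<beta> n * (2 * x) ^ n \<le> exp (T + 1)"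
      unfolding ml_coeff_def exp_minus by (simp add: field_simps del: exp_le_cancel_iff)
    then have "ml_coeff \<beta> n * x ^ n \<le> exp (T + 1) * (1 / 2) ^ n"
      by (simp add: power_mult_distrib power_one_over field_simps)
    then show "norm (ml_coeff \<beta> n * x ^ n) \<le> exp (T + 1) * (1 / 2) ^ n"
      using x ml_coeff_pos[OF assms, of n] by (simp add: less_imp_le)
  qed
qed

section \<open>A Beta function inequality\<close>

lemma Gamma_plus1_pos:
  fixes x :: real
  assumes "0 < x"
  shows "Gamma (x + 1) = x * Gamma x"
  by (rule Gamma_plus1) (use assms in \<open>auto elim!: nonpos_Ints_cases\<close>)

lemma Beta_1_left:
  fixes b :: real
  assumes "0 < b"
  shows "Beta 1 b = 1 / b"
  using assms Gamma_plus1_pos[of b] less_imp_neq[OF Gamma_real_pos[OF assms]] by (simp add: Beta_def add.commute)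

text \<open>
  The bound \<open>1 \<le> t powr (\<beta> - 1)\<close> on \<open>(0, 1)\<close> alone would only give a weak inequality between
  integrals; the linear term makes the comparison below strict.
\<close>

lemma powr_ge_linear:
  fixes t \<beta> :: real
  assumes "0 < t" "\<beta> \<le> 1"
  shows "1 + (1 - \<beta>) * (1 - t) \<le> t powr (\<beta> - 1)"
proof -
  have "(1 - \<beta>) * (1 - t) \<le> (1 - \<beta>) * (- ln t)"
    using ln_le_minus_one[OF assms(1)] assms by (intro mult_left_mono) auto
  also have "1 + (1 - \<beta>) * (- ln t) \<le> exp ((1 - \<beta>) * (- ln t))"
    by (rule exp_ge_add_one_self)
  also have "\<dots> = t powr (\<beta> - 1)"
    using assms by (simp add: powr_def algebra_simps)
  finally show ?thesis by simp
qed

text \<open>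
  The left-hand side is \<open>B(1, \<beta>) - B(1, 2\<beta>)\<close>. The two differences are integrals of the positive
  function \<open>(1 - t)\<^bsup>\<beta>-1\<^esup> - (1 - t)\<^bsup>2\<beta>-1\<^esup>\<close> against the weights \<open>1\<close> and \<open>t\<^bsup>\<beta>-1\<^esup>\<close>,
  and the second weight exceeds the first by at least \<open>(1 - \<beta>)(1 - t)\<close>.
\<close>

lemma Beta_diff_gt:
  fixes \<beta> :: real
  assumes "0 < \<beta>" "\<beta> < 1"
  shows "1 / (2 * \<beta>) < Beta \<beta> \<beta> - Beta \<beta> (2 * \<beta>)"
proof -
  define h where "h a b = (\<lambda>t. t powr (a - 1) * (1 - t) powr (b - 1))" for a b :: real
  have h: "(h a b has_integral Beta a b) {0<..<1}" if "0 < a" "0 < b" for a b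
    using has_integral_Beta_real[OF that] by (simp add: has_integral_Icc_iff_Ioo h_def)
  \<comment> \<open>The integrand with \<open>t powr (\<beta> - 1)\<close> replaced by \<open>1 + (1 - \<beta>) * (1 - t)\<close>, written as a
      combination of Beta integrands.\<close>
  define L where "L t = (h 1 \<beta> t - h 1 (2 * \<beta>) t)
      + (1 - \<beta>) * (h 1 (\<beta> + 1) t - h 1 (2 * \<beta> + 1) t)" for t
  have "(L has_integral (Beta 1 \<beta> - Beta 1 (2 * \<beta>))
      + (1 - \<beta>) * (Beta 1 (\<beta> + 1) - Beta 1 (2 * \<beta> + 1))) {0<..<1}"
    unfolding L_def using assms
    by (intro has_integral_add has_integral_diff has_integral_mult_right h) auto
  moreover have "((\<lambda>t. h \<beta> \<beta> t - h \<beta> (2 * \<beta>) t) has_integral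
      Beta \<beta> \<beta> - Beta \<beta> (2 * \<beta>)) {0<..<1}"
    using assms by (intro has_integral_diff h) auto
  moreover have "L t \<le> h \<beta> \<beta> t - h \<beta> (2 * \<beta>) t" if t: "t \<in> {0<..<1}" for t
  proof -
    define d where "d = (1 - t) powr (\<beta> - 1) - (1 - t) powr (2 * \<beta> - 1)"
    have "0 \<le> d"
      using t assms unfolding d_def by (simp add: powr_mono')
    have shift: "(1 - t) powr b = (1 - t) * (1 - t) powr (b - 1)" for b
      using t by (simp add: powr_diff)
    have "L t = (1 + (1 - \<beta>) * (1 - t)) * d"
      using t unfolding L_def h_def d_def add_diff_cancel_right' shift[of \<beta>] shift[of "2 * \<beta>"]
      by (simp add: algebra_simps)
    also have "\<dots> \<le> t powr (\<beta> - 1) * d"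
      using t assms \<open>0 \<le> d\<close> by (intro mult_right_mono powr_ge_linear) auto
    finally show ?thesis by (simp add: h_def d_def algebra_simps)
  qed
  ultimately have "(Beta 1 \<beta> - Beta 1 (2 * \<beta>))
      + (1 - \<beta>) * (Beta 1 (\<beta> + 1) - Beta 1 (2 * \<beta> + 1)) \<le> Beta \<beta> \<beta> - Beta \<beta> (2 * \<beta>)"
    by (rule has_integral_le)
  moreover have "Beta 1 \<beta> - Beta 1 (2 * \<beta>) = 1 / (2 * \<beta>)"
    using assms by (simp add: Beta_1_left field_simps)
  moreover have "0 < (1 - \<beta>) * (Beta 1 (\<beta> + 1) - Beta 1 (2 * \<beta> + 1))"
    using assms by (intro mult_pos_pos) (simp_all add: Beta_1_left frac_less2)
  ultimately show ?thesis by linarith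
qed

lemma ml_coeff_Gamma:
  assumes "0 < \<beta>" "0 < n"
  shows "ml_coeff \<beta> n = 1 / (real n * \<beta> * Gamma (real n * \<beta>))"
  using assms Gamma_plus1_pos[of "\<beta> * real n"]
  by (simp add: ml_coeff_def mult.commute)

lemma ml_coeff_2_ratio:
  assumes "0 < \<beta>"
  shows "ml_coeff \<beta> 2 / ml_coeff \<beta> 1 ^ 2 = \<beta> / 2 * Beta \<beta> \<beta>"
proof -
  have "\<beta> + \<beta> = 2 * \<beta>" by simp
  moreover have "0 < Gamma \<beta>" "0 < Gamma (2 * \<beta>)"
    using assms by (intro Gamma_real_pos; simp)+
  ultimately show ?thesis
    using assms by (simp add: ml_coeff_Gamma Beta_def power2_eq_square)
qed

lemma ml_coeff_3_ratio:
  assumes "0 < \<beta>"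
  shows "ml_coeff \<beta> 3 / (ml_coeff \<beta> 1 * ml_coeff \<beta> 2) = 2 * \<beta> / 3 * Beta \<beta> (2 * \<beta>)"
proof -
  have "\<beta> + 2 * \<beta> = 3 * \<beta>" by simp
  moreover have "0 < Gamma \<beta>" "0 < Gamma (2 * \<beta>)" "0 < Gamma (3 * \<beta>)"
    using assms by (intro Gamma_real_pos; simp)+
  ultimately show ?thesis
    using assms by (simp add: ml_coeff_Gamma Beta_def)
qed

text \<open>
  The mixing variable has variance \<open>2 * ml_coeff \<beta> 2 - ml_coeff \<beta> 1 ^ 2\<close>. By
  \<open>ml_coeff_2_ratio\<close> its sign is that of \<open>B(\<beta>, \<beta>) - 1/\<beta>\<close>, and \<open>1/\<beta> = B(1, \<beta>)\<close>.
\<close>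

lemma ml_coeff_variance_nonneg:
  assumes "0 < \<beta>" "\<beta> \<le> 1"
  shows "ml_coeff \<beta> 1 ^ 2 \<le> 2 * ml_coeff \<beta> 2"
proof -
  have "1 / \<beta> \<le> Beta \<beta> \<beta>"
    using Beta_real_mono[of \<beta> 1 \<beta> \<beta>] assms by (simp add: Beta_1_left)
  then have "1 / 2 \<le> ml_coeff \<beta> 2 / ml_coeff \<beta> 1 ^ 2"
    using assms by (subst ml_coeff_2_ratio) (auto simp: field_simps)
  then show ?thesis
    using ml_coeff_pos[OF assms(1), of 1] by (simp add: field_simps)
qed

text \<open>
  Dividing by \<open>ml_coeff \<beta> 1 ^ 2 * ml_coeff \<beta> 2\<close> leaves exactly the two Gamma quotients that are
  Beta values, and the claim becomes \<open>Beta_diff_gt\<close>. At \<open>\<beta> = 1\<close>, and in the limit \<open>\<beta> \<rightarrow> 0\<close>, both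
  sides agree.
\<close>

lemma ml_coeff_cubic_ineq:
  assumes "0 < \<beta>" "\<beta> < 1"
  shows "3 * (ml_coeff \<beta> 1 * ml_coeff \<beta> 3) + ml_coeff \<beta> 1 ^ 2 * ml_coeff \<beta> 2 < 4 * ml_coeff \<beta> 2 ^ 2"
proof -
  define c where "c = ml_coeff \<beta>"
  have pos: "0 < c 1" "0 < c 2" using ml_coeff_pos assms by (auto simp: c_def)
  have "1 < 2 * \<beta> * (Beta \<beta> \<beta> - Beta \<beta> (2 * \<beta>))"
    using Beta_diff_gt[OF assms] assms by (simp add: field_simps)
  also have "\<dots> = 4 * (c 2 / c 1 ^ 2) - 3 * (c 3 / (c 1 * c 2))"
    using assms unfolding c_def by (simp only: ml_coeff_2_ratio ml_coeff_3_ratio) (simp add: algebra_simps)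
  finally have "1 * (c 1 ^ 2 * c 2) < (4 * (c 2 / c 1 ^ 2) - 3 * (c 3 / (c 1 * c 2))) * (c 1 ^ 2 * c 2)"
    using pos by (intro mult_strict_right_mono) auto
  also have "\<dots> = 4 * c 2 ^ 2 - 3 * (c 1 * c 3)"
    using pos by (simp add: field_simps power2_eq_square)
  finally show ?thesis by (simp add: c_def)
qed

section \<open>Generating functions of lattice-valued random variables\<close>

lemma sums_integral_nonneg:
  fixes f :: "nat \<Rightarrow> 'a \<Rightarrow> real"
  assumes int: "\<And>n. integrable M (f n)" and nonneg: "\<And>n. AE x in M. 0 \<le> f n x"
    and sums: "AE x in M. (\<lambda>n. f n x) sums F x" and F: "integrable M F"
  shows "(\<lambda>n. \<integral>x. f n x \<partial>M) sums (\<integral>x. F x \<partial>M)"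
proof -
  have nonneg_all: "AE x in M. \<forall>n. 0 \<le> f n x"
    using nonneg by (simp add: AE_all_countable)
  have meas [measurable]: "f n \<in> borel_measurable M" "F \<in> borel_measurable M" for n
    using int F by auto
  have "AE x in M. summable (\<lambda>n. norm (f n x))"
    using nonneg_all sums by eventually_elim (auto simp: sums_iff)
  moreover have "summable (\<lambda>n. \<integral>x. norm (f n x) \<partial>M)"
  proof (rule summableI_nonneg_bounded)
    fix N
    have "(\<Sum>n<N. \<integral>x. norm (f n x) \<partial>M) = (\<integral>x. (\<Sum>n<N. norm (f n x)) \<partial>M)"
      using int by simp
    also have "\<dots> \<le> (\<integral>x. F x \<partial>M)"
    proof (rule integral_mono_AE)
      show "AE x in M. (\<Sum>n<N. norm (f n x)) \<le> F x"
        using nonneg_all sums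
      proof eventually_elim
        case (elim x)
        then have "(\<Sum>n<N. f n x) \<le> F x"
          using sum_le_suminf[of "\<lambda>n. f n x" "{..<N}"] by (auto simp: sums_iff)
        then show ?case using elim by simp
      qed
    qed (use int F in auto)
    finally show "(\<Sum>n<N. \<integral>x. norm (f n x) \<partial>M) \<le> (\<integral>x. F x \<partial>M)" .
  qed simp
  ultimately have "(\<lambda>n. \<integral>x. f n x \<partial>M) sums (\<integral>x. (\<Sum>n. f n x) \<partial>M)"
    using int by (intro sums_integral)
  also have "(\<integral>x. (\<Sum>n. f n x) \<partial>M) = (\<integral>x. F x \<partial>M)"
    using sums by (intro integral_cong_AE) (auto simp: sums_iff)
  finally show ?thesis .
qed

lemma exp_mult_ln_of_nat:
  fixes u x :: real
  assumes "0 < u" "x = real m"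
  shows "exp (x * ln u) = u ^ m"
  using assms by (simp add: powr_def powr_realpow[symmetric])

lemma point_measure_distr_nat:
  assumes "prob_space M" and N: "N \<in> measurable M (count_space UNIV)"
  shows "distr M (count_space UNIV) N
    = point_measure (UNIV :: nat set) (\<lambda>k. ennreal (measure M {x \<in> space M. N x = k}))"
proof (rule measure_eqI_countable)
  interpret prob_space M by fact
  note [measurable] = N
  show "sets (distr M (count_space UNIV) N) = Pow UNIV"
    "sets (point_measure (UNIV :: nat set) (\<lambda>k. ennreal (measure M {x \<in> space M. N x = k}))) = Pow UNIV"
    by (simp_all add: sets_point_measure)
  fix k :: nat
  have "emeasure (distr M (count_space UNIV) N) {k} = emeasure M {x \<in> space M. N x = k}"
    by (subst emeasure_distr[OF N]) (auto intro!: arg_cong[where f = "emeasure M"])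
  then show "emeasure (distr M (count_space UNIV) N) {k}
      = emeasure (point_measure (UNIV :: nat set) (\<lambda>k. ennreal (measure M {x \<in> space M. N x = k}))) {k}"
    by (simp add: emeasure_point_measure_finite2 emeasure_eq_measure)
qed simp

lemma pgf_sums:
  assumes "prob_space M" and N: "N \<in> measurable M (count_space UNIV)"
    and int: "has_bochner_integral M (\<lambda>x. u ^ N x) (I :: real)"
  shows "(\<lambda>k. measure M {x \<in> space M. N x = k} * u ^ k) sums I"
proof -
  define p where "p k = measure M {x \<in> space M. N x = k}" for k
  have D: "distr M (count_space UNIV) N = density (count_space UNIV) (\<lambda>k. ennreal (p k))"
    using point_measure_distr_nat[OF assms(1,2)] by (simp add: point_measure_def p_def)
  have "integrable (distr M (count_space UNIV) N) (\<lambda>k. u ^ k)"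
    using int by (subst integrable_distr_eq[OF N]) (auto simp: has_bochner_integral_iff)
  then have "integrable (count_space UNIV) (\<lambda>k. p k * u ^ k)"
    unfolding D by (subst (asm) integrable_density) (auto simp: p_def)
  then have "(\<lambda>k. p k * u ^ k) sums (\<integral>k. p k * u ^ k \<partial>count_space UNIV)"
    by (rule sums_integral_count_space_nat)
  also have "(\<integral>k. p k * u ^ k \<partial>count_space UNIV) = (\<integral>k. u ^ k \<partial>distr M (count_space UNIV) N)"
    unfolding D by (subst integral_density) (auto simp: p_def)
  also have "\<dots> = I"
    using int by (subst integral_distr[OF N]) (auto simp: has_bochner_integral_iff)
  finally show ?thesis by (simp add: p_def)
qed

text \<open>
  With \<open>u = exp s\<close> the hypothesis states that the probability generating function of \<open>X\<close> is
  \<open>E\<^sub>\<beta>(\<lambda>(u - 1))\<close> for \<open>u > 0\<close>. Its \<open>k\<close>-th Taylor coefficient at \<open>0\<close> is the defining weight of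
  \<open>fractional_poisson\<close>. Being probabilities of \<open>X\<close>, these weights are nonnegative, so
  the truncation in \<open>ennreal\<close> does not change them.
\<close>

lemma distr_eq_fractional_poisson:
  fixes X :: "'a \<Rightarrow> real"
  assumes "prob_space M" and X [measurable]: "X \<in> borel_measurable M"
    and nat: "AE x in M. X x \<in> \<nat>" and "0 < \<beta>" "0 < lam"
    and laplace: "\<And>s. has_bochner_integral M (\<lambda>x. exp (X x * s)) (mittag_leffler \<beta> (lam * (exp s - 1)))"
  shows "distr M borel X = fractional_poisson \<beta> lam"
proof -
  define N where "N x = nat \<lfloor>X x\<rfloor>" for x
  have N [measurable]: "N \<in> measurable M (count_space UNIV)"
    unfolding N_def by measurable
  have XN: "AE x in M. X x = real (N x)"
    using nat by eventually_elim (auto simp: N_def elim!: Nats_cases)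
  define p where "p k = measure M {x \<in> space M. N x = k}" for k
  have pgf: "(\<lambda>k. p k * u ^ k) sums mittag_leffler \<beta> (lam * (u - 1))" if "0 < u" for u
    unfolding p_def
  proof (rule pgf_sums[OF assms(1) N])
    have "AE x in M. exp (X x * ln u) = u ^ N x"
      using XN by eventually_elim (use that in \<open>auto intro: exp_mult_ln_of_nat\<close>)
    then show "has_bochner_integral M (\<lambda>x. u ^ N x) (mittag_leffler \<beta> (lam * (u - 1)))"
      using laplace[of "ln u"] that
      by (subst has_bochner_integral_cong_AE[where g = "\<lambda>x. exp (X x * ln u)"]) auto
  qed
  have p: "p k = lam ^ k / fact k * (deriv ^^ k) (mittag_leffler \<beta>) (- lam)" for k
  proof -
    have "fact k * p k = lam ^ k * (\<Sum>n. (diffs ^^ k) (ml_coeff \<beta>) n * (- lam) ^ n)"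
    proof (rule powser_affine_transfer)
      show "summable (\<lambda>n. p n * z ^ n)" for z
        by (rule summable_powser_everywhere) (rule sums_summable[OF pgf])
      show "summable (\<lambda>n. ml_coeff \<beta> n * z ^ n)" for z
        by (rule summable_mittag_leffler) fact
      show "(\<Sum>n. p n * u ^ n) = (\<Sum>n. ml_coeff \<beta> n * (lam * u + - lam) ^ n)" if "0 < u" for u
        using pgf[OF that] by (simp add: sums_iff mittag_leffler_powser algebra_simps)
    qed
    also have "(\<Sum>n. (diffs ^^ k) (ml_coeff \<beta>) n * (- lam) ^ n) = (deriv ^^ k) (mittag_leffler \<beta>) (- lam)"
      unfolding mittag_leffler_powser
      by (subst higher_deriv_powser) (auto intro: summable_mittag_leffler[OF \<open>0 < \<beta>\<close>])
    finally show ?thesis by (simp add: field_simps)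
  qed
  have "distr M borel X = distr M borel (\<lambda>x. real (N x))"
    using XN by (intro distr_cong_AE) auto
  also have "\<dots> = distr (distr M (count_space UNIV) N) borel real"
    by (subst distr_distr) (auto simp: o_def)
  also have "\<dots> = fractional_poisson \<beta> lam"
    unfolding point_measure_distr_nat[OF assms(1) N] fractional_poisson_def p[symmetric] p_def ..
  finally show ?thesis .
qed

section \<open>Factorial moments\<close>

text \<open>
  The bound \<open>m choose k \<le> 2 ^ m\<close> is stated through \<open>exp\<close> so that integrability of all factorial
  moments follows from finiteness of the Laplace transform at \<open>s\<^sub>1 = s\<^sub>2 = ln 2\<close>.
\<close>

lemma gchoose_of_nat_bounds:
  fixes x :: real
  assumes "x \<in> \<nat>"
  shows "0 \<le> x gchoose k" "x gchoose k \<le> exp (x * ln 2)"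
proof -
  obtain m where m: "x = real m" using assms by (rule Nats_cases)
  have "x gchoose k = real (m choose k)" by (simp add: m binomial_gbinomial)
  moreover have "real (m choose k) \<le> 2 ^ m"
  proof (cases "k \<le> m")
    case True
    then have "m choose k \<le> (\<Sum>i\<le>m. m choose i)" by (intro member_le_sum) auto
    then show ?thesis by (simp add: choose_row_sum flip: of_nat_le_iff)
  qed (simp add: binomial_eq_0)
  ultimately show "0 \<le> x gchoose k" "x gchoose k \<le> exp (x * ln 2)"
    by (simp_all add: exp_mult_ln_of_nat[OF _ m])
qed

lemma exp_ln_sums_gchoose:
  fixes x y :: real
  assumes "x \<in> \<nat>" "0 \<le> y"
  shows "(\<lambda>k. (x gchoose k) * y ^ k) sums exp (x * ln (1 + y))"
    and "summable (\<lambda>k. norm ((x gchoose k) * y ^ k))"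
proof -
  obtain m where m: "x = real m" using assms by (auto elim: Nats_cases)
  have ch: "(x gchoose k) = real (m choose k)" for k by (simp add: m binomial_gbinomial)
  have "(\<lambda>k. (x gchoose k) * y ^ k) sums (\<Sum>k\<le>m. (x gchoose k) * y ^ k)"
    by (rule sums_finite) (auto simp: ch binomial_eq_0)
  also have "(\<Sum>k\<le>m. (x gchoose k) * y ^ k) = (y + 1) ^ m"
    by (subst binomial_ring) (simp add: ch)
  also have "\<dots> = exp (x * ln (1 + y))"
    using exp_mult_ln_of_nat[of "1 + y" x m] m assms by (simp add: add.commute)
  finally show "(\<lambda>k. (x gchoose k) * y ^ k) sums exp (x * ln (1 + y))" .
  then show "summable (\<lambda>k. norm ((x gchoose k) * y ^ k))"
    using assms by (auto simp: ch sums_iff)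
qed

lemma borel_measurable_gchoose [measurable]:
  "(\<lambda>x::real. x gchoose k) \<in> borel_measurable borel"
  unfolding gbinomial_prod_rev by measurable

context
  fixes \<beta> lam1 lam2 :: real and P :: "(real \<times> real) measure"
  assumes \<beta>: "0 < \<beta>" and lam: "0 < lam1" "0 < lam2" and P: "is_fractional_poisson2 \<beta> lam1 lam2 P"
begin

lemma fp2_prob_space: "prob_space P"
  using P by (simp add: is_fractional_poisson2_def)

lemma fp2_sets [measurable_cong]: "sets P = sets (borel \<Otimes>\<^sub>M borel)"
  using P unfolding is_fractional_poisson2_def borel_prod by simp

lemma fp2_AE_Nats: "AE x in P. fst x \<in> \<nat> \<and> snd x \<in> \<nat>"
  using P by (auto simp: is_fractional_poisson2_def mem_Times_iff)

lemma fp2_laplace: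
  "has_bochner_integral P (\<lambda>x. exp (fst x * s1 + snd x * s2))
     (mittag_leffler \<beta> (lam1 * (exp s1 - 1) + lam2 * (exp s2 - 1)))"
  using P by (simp add: is_fractional_poisson2_def case_prod_beta')

lemma fp2_marginals:
  "distr P borel fst = fractional_poisson \<beta> lam1"
  "distr P borel snd = fractional_poisson \<beta> lam2"
proof -
  show "distr P borel fst = fractional_poisson \<beta> lam1"
  proof (rule distr_eq_fractional_poisson)
    show "has_bochner_integral P (\<lambda>x. exp (fst x * s)) (mittag_leffler \<beta> (lam1 * (exp s - 1)))" for s
      using fp2_laplace[of s 0] by simp
  qed (use fp2_AE_Nats fp2_prob_space \<beta> lam in auto)
  show "distr P borel snd = fractional_poisson \<beta> lam2"
  proof (rule distr_eq_fractional_poisson)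
    show "has_bochner_integral P (\<lambda>x. exp (snd x * s)) (mittag_leffler \<beta> (lam2 * (exp s - 1)))" for s
      using fp2_laplace[of 0 s] by simp
  qed (use fp2_AE_Nats fp2_prob_space \<beta> lam in auto)
qed

lemma fp2_integrable_gchoose: "integrable P (\<lambda>x. (fst x gchoose i) * (snd x gchoose j))"
proof (rule Bochner_Integration.integrable_bound)
  show "integrable P (\<lambda>x. exp (fst x * ln 2 + snd x * ln 2))"
    using fp2_laplace has_bochner_integral_iff by blast
  show "AE x in P. norm ((fst x gchoose i) * (snd x gchoose j)) \<le> norm (exp (fst x * ln 2 + snd x * ln 2))"
    using fp2_AE_Nats
    by eventually_elim (auto simp: exp_add abs_mult gchoose_of_nat_bounds intro!: mult_mono)
qed measurable

text \<open>
  The Laplace transform along the ray \<open>(exp s\<^sub>1, exp s\<^sub>2) = (1 + a t, 1 + t)\<close>. For \<open>a, t > 0\<close> all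
  terms of the product of the two binomial series are nonnegative, so they may be integrated one
  by one. Grouping them by total degree \<open>n\<close> leaves a power series in the single variable \<open>t\<close>.
\<close>

lemma fp2_gchoose_sums:
  assumes "0 < a" "0 < t"
  shows "(\<lambda>n. (\<Sum>i\<le>n. (\<integral>x. (fst x gchoose i) * (snd x gchoose (n - i)) \<partial>P) * a ^ i) * t ^ n)
    sums mittag_leffler \<beta> ((lam1 * a + lam2) * t)"
proof -
  define f where "f n x = (\<Sum>i\<le>n. ((fst x gchoose i) * (snd x gchoose (n - i))) * a ^ i) * t ^ n"
    for n and x :: "real \<times> real"
  define s1 s2 where "s1 = ln (1 + a * t)" and "s2 = ln (1 + t)"
  have e: "exp s1 = 1 + a * t" "exp s2 = 1 + t"
    using assms by (auto simp: s1_def s2_def add_pos_pos)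
  have F: "has_bochner_integral P (\<lambda>x. exp (fst x * s1 + snd x * s2))
      (mittag_leffler \<beta> ((lam1 * a + lam2) * t))"
    using fp2_laplace[of s1 s2] by (simp add: e algebra_simps)
  have int: "integrable P (f n)" for n
    unfolding f_def by (intro Bochner_Integration.integrable_sum integrable_mult_left fp2_integrable_gchoose)
  have "(\<lambda>n. \<integral>x. f n x \<partial>P) sums (\<integral>x. exp (fst x * s1 + snd x * s2) \<partial>P)"
  proof (rule sums_integral_nonneg)
    show "integrable P (f n)" for n by fact
    show "AE x in P. 0 \<le> f n x" for n
      using fp2_AE_Nats
      by eventually_elim
        (use assms in \<open>auto simp: f_def gchoose_of_nat_bounds intro!: mult_nonneg_nonneg sum_nonneg\<close>)
    show "AE x in P. (\<lambda>n. f n x) sums exp (fst x * s1 + snd x * s2)"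
      using fp2_AE_Nats
    proof eventually_elim
      case (elim x)
      note s = exp_ln_sums_gchoose[of "fst x" "a * t"] exp_ln_sums_gchoose[of "snd x" t]
      have "(\<lambda>n. \<Sum>i\<le>n. ((fst x gchoose i) * (a * t) ^ i) * ((snd x gchoose (n - i)) * t ^ (n - i)))
          sums ((\<Sum>k. (fst x gchoose k) * (a * t) ^ k) * (\<Sum>k. (snd x gchoose k) * t ^ k))"
        using elim assms s by (intro Cauchy_product_sums) auto
      also have "(\<Sum>k. (fst x gchoose k) * (a * t) ^ k) * (\<Sum>k. (snd x gchoose k) * t ^ k)
          = exp (fst x * s1 + snd x * s2)"
        using elim assms s(1,3) by (auto simp: sums_iff s1_def s2_def exp_add)
      also have "(\<lambda>n. \<Sum>i\<le>n. ((fst x gchoose i) * (a * t) ^ i) * ((snd x gchoose (n - i)) * t ^ (n - i)))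
          = (\<lambda>n. f n x)"
      proof
        fix n
        have "t ^ n = t ^ i * t ^ (n - i)" if "i \<le> n" for i
          using that by (simp flip: power_add)
        then show "(\<Sum>i\<le>n. ((fst x gchoose i) * (a * t) ^ i) * ((snd x gchoose (n - i)) * t ^ (n - i))) = f n x"
          unfolding f_def sum_distrib_right
          by (intro sum.cong) (auto simp: power_mult_distrib)
      qed
      finally show ?case .
    qed
    show "integrable P (\<lambda>x. exp (fst x * s1 + snd x * s2))"
      using F by (simp add: has_bochner_integral_iff)
  qed
  moreover have "(\<integral>x. f n x \<partial>P)
      = (\<Sum>i\<le>n. (\<integral>x. (fst x gchoose i) * (snd x gchoose (n - i)) \<partial>P) * a ^ i) * t ^ n" for n
    unfolding f_def by (simp add: fp2_integrable_gchoose)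
  ultimately show ?thesis
    using F by (simp add: has_bochner_integral_iff)
qed

text \<open>
  Uniqueness of power series is used twice: in \<open>t\<close>, which isolates the moments of total degree
  \<open>n\<close>, and then in \<open>a\<close>, where both sides are polynomials and the right-hand one is the binomial
  expansion of \<open>(\<lambda>\<^sub>1 a + \<lambda>\<^sub>2)\<^sup>n\<close>.
\<close>

lemma fp2_factorial_moment:
  "(\<integral>x. (fst x gchoose i) * (snd x gchoose j) \<partial>P)
    = real ((i + j) choose i) * ml_coeff \<beta> (i + j) * lam1 ^ i * lam2 ^ j"
proof -
  define M where "M i j = (\<integral>x. (fst x gchoose i) * (snd x gchoose j) \<partial>P)" for i j
  define n where "n = i + j"
  have row: "(\<Sum>i\<le>n. M i (n - i) * a ^ i) = ml_coeff \<beta> n * (lam1 * a + lam2) ^ n" if a: "0 < a" for a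
  proof (rule powser_unique_pos)
    fix t :: real assume t: "0 < t"
    show "(\<lambda>n. (\<Sum>i\<le>n. M i (n - i) * a ^ i) * t ^ n) sums mittag_leffler \<beta> ((lam1 * a + lam2) * t)"
      using fp2_gchoose_sums[OF a t] by (simp add: M_def)
    show "(\<lambda>n. ml_coeff \<beta> n * (lam1 * a + lam2) ^ n * t ^ n) sums mittag_leffler \<beta> ((lam1 * a + lam2) * t)"
      using summable_sums[OF summable_mittag_leffler[OF \<beta>, of "(lam1 * a + lam2) * t"]]
      by (simp add: mittag_leffler_powser power_mult_distrib mult.assoc)
  qed
  have "(\<lambda>i. if i \<le> n then M i (n - i) else 0) i
      = (\<lambda>i. if i \<le> n then real (n choose i) * ml_coeff \<beta> n * lam1 ^ i * lam2 ^ (n - i) else 0) i"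
  proof (rule powser_unique_pos[where k = i and a = "\<lambda>i. if i \<le> n then M i (n - i) else 0"])
    fix a :: real assume a: "0 < a"
    have finite: "(\<lambda>i. (if i \<le> n then g i else 0) * a ^ i) sums (\<Sum>i\<le>n. g i * a ^ i)" for g :: "nat \<Rightarrow> real"
    proof -
      have "(\<lambda>i. (if i \<le> n then g i else 0) * a ^ i) sums (\<Sum>i\<le>n. (if i \<le> n then g i else 0) * a ^ i)"
        by (rule sums_finite) auto
      then show ?thesis by simp
    qed
    show "(\<lambda>i. (if i \<le> n then M i (n - i) else 0) * a ^ i) sums (ml_coeff \<beta> n * (lam1 * a + lam2) ^ n)"
      using finite[of "\<lambda>i. M i (n - i)"] row[OF a] by simp
    have "ml_coeff \<beta> n * (lam1 * a + lam2) ^ n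
        = (\<Sum>i\<le>n. real (n choose i) * ml_coeff \<beta> n * lam1 ^ i * lam2 ^ (n - i) * a ^ i)"
      by (subst binomial_ring) (simp add: sum_distrib_left power_mult_distrib mult_ac)
    then show "(\<lambda>i. (if i \<le> n then real (n choose i) * ml_coeff \<beta> n * lam1 ^ i * lam2 ^ (n - i) else 0) * a ^ i)
        sums (ml_coeff \<beta> n * (lam1 * a + lam2) ^ n)"
      using finite[of "\<lambda>i. real (n choose i) * ml_coeff \<beta> n * lam1 ^ i * lam2 ^ (n - i)"] by simp
  qed
  then show ?thesis by (simp add: M_def n_def)
qed

lemma fp2_has_gchoose:
  "has_bochner_integral P (\<lambda>x. (fst x gchoose i) * (snd x gchoose j))
     (real ((i + j) choose i) * ml_coeff \<beta> (i + j) * lam1 ^ i * lam2 ^ j)"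
  by (simp add: has_bochner_integral_iff fp2_integrable_gchoose fp2_factorial_moment)

end

lemma power_gchoose:
  fixes x :: real
  shows "x ^ 2 = 2 * (x gchoose 2) + x" "x ^ 3 = 6 * (x gchoose 3) + 6 * (x gchoose 2) + x"
  by (simp_all add: gbinomial_prod_rev numeral_eq_Suc prod.atLeast0_lessThan_Suc field_simps power2_eq_square)

section \<open>The covariance of the orthogonal polynomials\<close>

lemma gram_schmidt_0: "gram_schmidt_poly \<beta> lam 0 = 1"
  by (simp add: gram_schmidt_poly.simps[of _ _ 0])

context
  fixes M :: "real measure" and \<beta> lam :: real
  assumes M: "M = fractional_poisson \<beta> lam" "prob_space M"
begin

lemma fp_inner_eqI: "has_bochner_integral M (\<lambda>x. poly p x * poly q x) I \<Longrightarrow> fp_inner \<beta> lam p q = I"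
  by (simp add: fp_inner_def has_bochner_integral_iff flip: M(1))

lemma fp_has_const: "has_bochner_integral M (\<lambda>x. c :: real) c"
  using M(2) by (simp add: has_bochner_integral_iff prob_space.prob_space prob_space.finite_measure finite_measure.integrable_const)

lemma gram_schmidt_1:
  assumes "has_bochner_integral M (\<lambda>x. x) m1"
  shows "gram_schmidt_poly \<beta> lam 1 = [:- m1, 1:]"
proof -
  have "fp_inner \<beta> lam 1 1 = 1"
    using fp_has_const[of 1] by (intro fp_inner_eqI) simp
  moreover have "fp_inner \<beta> lam (monom 1 1) 1 = m1"
    using assms by (intro fp_inner_eqI) (simp add: poly_monom)
  ultimately show ?thesis
    by (subst gram_schmidt_poly.simps) (simp add: gram_schmidt_0 monom_altdef one_pCons)
qed

lemma gram_schmidt_2: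
  assumes m: "has_bochner_integral M (\<lambda>x. x) m1" "has_bochner_integral M (\<lambda>x. x ^ 2) m2"
      "has_bochner_integral M (\<lambda>x. x ^ 3) m3"
  shows "gram_schmidt_poly \<beta> lam 2
    = (let A = (m3 - m1 * m2) / (m2 - m1 ^ 2) in [:A * m1 - m2, - A, 1:])"
proof -
  have "fp_inner \<beta> lam 1 1 = 1"
    using fp_has_const[of 1] by (intro fp_inner_eqI) simp
  moreover have "fp_inner \<beta> lam (monom 1 2) 1 = m2"
    using m(2) by (intro fp_inner_eqI) (simp add: poly_monom)
  moreover have "fp_inner \<beta> lam (monom 1 2) [:- m1, 1:] = m3 - m1 * m2"
    using has_bochner_integral_diff[OF m(3) has_bochner_integral_mult_right[OF m(2), of m1]]
    by (intro fp_inner_eqI) (simp add: poly_monom algebra_simps eval_nat_numeral)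
  moreover have "fp_inner \<beta> lam [:- m1, 1:] [:- m1, 1:] = m2 - m1 ^ 2"
  proof (rule fp_inner_eqI)
    have "has_bochner_integral M (\<lambda>x. x ^ 2 - 2 * m1 * x + m1 ^ 2) (m2 - 2 * m1 * m1 + m1 ^ 2)"
      by (intro has_bochner_integral_add has_bochner_integral_diff has_bochner_integral_mult_right
          m fp_has_const)
    then show "has_bochner_integral M (\<lambda>x. poly [:- m1, 1:] x * poly [:- m1, 1:] x) (m2 - m1 ^ 2)"
      by (simp add: algebra_simps power2_eq_square)
  qed
  ultimately show ?thesis
    by (subst gram_schmidt_poly.simps)
       (simp add: lessThan_Suc numeral_2_eq_2 gram_schmidt_0 gram_schmidt_1[OF m(1), unfolded One_nat_def]
          monom_altdef one_pCons Let_def)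
qed

end

text \<open>
  For \<open>a\<^sub>n = n! / \<Gamma>(\<beta>n + 1)\<close> the parameters \<open>m1\<close>, \<open>m2\<close>, \<open>m3\<close> are the moments of \<open>x\<^sub>2\<close>. The two
  parenthesised combinations with \<open>l1\<close> are then the covariances of \<open>x\<^sub>1\<close> with \<open>x\<^sub>2\<^sup>2\<close> and with \<open>x\<^sub>2\<close>, and the quotient is
  the coefficient of \<open>x\<close> in the second orthogonal polynomial, up to sign.
\<close>

lemma covariance_algebra:
  fixes l1 l2 a1 a2 a3 :: real
  defines "m1 \<equiv> l2 * a1" and "m2 \<equiv> l2 ^ 2 * a2 + l2 * a1"
    and "m3 \<equiv> l2 ^ 3 * a3 + 3 * l2 ^ 2 * a2 + l2 * a1"
  assumes "m2 - m1 ^ 2 \<noteq> 0"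
  shows "((l1 * l2 ^ 2 * a3 + l1 * l2 * a2 - l1 * a1 * m2)
      - (m3 - m1 * m2) / (m2 - m1 ^ 2) * (l1 * l2 * a2 - l1 * a1 * m1)) * (m2 - m1 ^ 2)
    = l1 * l2 ^ 3 * (a1 * a3 + a1 ^ 2 * a2 - 2 * a2 ^ 2)"
proof -
  have clear: "(X - N / V * Y) * V = X * V - N * Y" if "V \<noteq> 0" for X N V Y :: real
    using that by (simp add: field_simps)
  have "((l1 * l2 ^ 2 * a3 + l1 * l2 * a2 - l1 * a1 * m2)
      - (m3 - m1 * m2) / (m2 - m1 ^ 2) * (l1 * l2 * a2 - l1 * a1 * m1)) * (m2 - m1 ^ 2)
    = (l1 * l2 ^ 2 * a3 + l1 * l2 * a2 - l1 * a1 * m2) * (m2 - m1 ^ 2)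
      - (m3 - m1 * m2) * (l1 * l2 * a2 - l1 * a1 * m1)"
    using clear[OF assms(4)] .
  also have "\<dots> = l1 * l2 ^ 3 * (a1 * a3 + a1 ^ 2 * a2 - 2 * a2 ^ 2)"
    unfolding m1_def m2_def m3_def by algebra
  finally show ?thesis .
qed

theorem corollary3p5:
  fixes \<beta> lam1 lam2 :: real and P :: "(real \<times> real) measure"
  assumes "0 < lam1" and "0 < lam2"
    and "0 < \<beta>" and "\<beta> \<le> 1"
    and "is_fractional_poisson2 \<beta> lam1 lam2 P"
  shows "(\<integral>(x1, x2). poly (gram_schmidt_poly \<beta> lam1 1) x1 * poly (gram_schmidt_poly \<beta> lam2 2) x2 \<partial>P) = 0
         \<longleftrightarrow> \<beta> = 1"
proof -
  note fp2 = assms(3,1,2,5)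
  interpret P: prob_space P
    using fp2 by (rule fp2_prob_space)
  have meas [measurable]: "fst \<in> borel_measurable P" "snd \<in> borel_measurable P"
    using measurable_cong_sets[OF fp2_sets[OF fp2] refl] by auto
  define c where "c = ml_coeff \<beta>"
  define a1 a2 a3 where "a1 = c 1" and "a2 = 2 * c 2" and "a3 = 6 * c 3"
  note fm = fp2_has_gchoose[OF fp2, folded c_def]
  have fst_moment: "has_bochner_integral P fst (lam1 * a1)"
    using fm[of 1 0] by (simp add: a1_def mult.commute)
  have snd_moments:
    "has_bochner_integral P snd (lam2 * a1)"
    "has_bochner_integral P (\<lambda>x. snd x ^ 2) (lam2 ^ 2 * a2 + lam2 * a1)"
    "has_bochner_integral P (\<lambda>x. snd x ^ 3) (lam2 ^ 3 * a3 + 3 * lam2 ^ 2 * a2 + lam2 * a1)"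
  proof -
    show 1: "has_bochner_integral P snd (lam2 * a1)"
      using fm[of 0 1] by (simp add: a1_def mult.commute)
    have 2: "has_bochner_integral P (\<lambda>x. snd x gchoose 2) (lam2 ^ 2 * c 2)"
      using fm[of 0 2] by (simp add: numeral_2_eq_2 mult.commute)
    have 3: "has_bochner_integral P (\<lambda>x. snd x gchoose 3) (lam2 ^ 3 * c 3)"
      using fm[of 0 3] by (simp add: mult.commute)
    show "has_bochner_integral P (\<lambda>x. snd x ^ 2) (lam2 ^ 2 * a2 + lam2 * a1)"
      using has_bochner_integral_add[OF has_bochner_integral_mult_right[OF 2, of 2] 1]
      by (simp add: power_gchoose[of "snd x" for x] a2_def mult_ac)
    show "has_bochner_integral P (\<lambda>x. snd x ^ 3) (lam2 ^ 3 * a3 + 3 * lam2 ^ 2 * a2 + lam2 * a1)"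
      using has_bochner_integral_add[OF has_bochner_integral_add[OF
          has_bochner_integral_mult_right[OF 3, of 6] has_bochner_integral_mult_right[OF 2, of 6]] 1]
      by (simp add: power_gchoose[of "snd x" for x] a2_def a3_def algebra_simps)
  qed
  have mixed_moments:
    "has_bochner_integral P (\<lambda>x. fst x * snd x) (lam1 * lam2 * a2)"
    "has_bochner_integral P (\<lambda>x. fst x * snd x ^ 2) (lam1 * lam2 ^ 2 * a3 + lam1 * lam2 * a2)"
  proof -
    show 11: "has_bochner_integral P (\<lambda>x. fst x * snd x) (lam1 * lam2 * a2)"
      using fm[of 1 1] by (simp add: a2_def numeral_2_eq_2 mult_ac)
    have 12: "has_bochner_integral P (\<lambda>x. fst x * (snd x gchoose 2)) (3 * (lam1 * lam2 ^ 2 * c 3))"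
      using fm[of 1 2] by (simp add: numeral_3_eq_3 mult_ac)
    show "has_bochner_integral P (\<lambda>x. fst x * snd x ^ 2) (lam1 * lam2 ^ 2 * a3 + lam1 * lam2 * a2)"
      using has_bochner_integral_add[OF has_bochner_integral_mult_right[OF 12, of 2] 11]
      by (simp add: power_gchoose[of "snd x" for x] a3_def algebra_simps)
  qed
  define m1 m2 m3 where "m1 = lam2 * a1" and "m2 = lam2 ^ 2 * a2 + lam2 * a1"
    and "m3 = lam2 ^ 3 * a3 + 3 * lam2 ^ 2 * a2 + lam2 * a1"
  define A where "A = (m3 - m1 * m2) / (m2 - m1 ^ 2)"
  note marg = fp2_marginals[OF fp2]
  have law: "has_bochner_integral (distr P borel X) f I"
    if "X \<in> borel_measurable P" "f \<in> borel_measurable borel" "has_bochner_integral P (\<lambda>x. f (X x)) I"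
    for X :: "real \<times> real \<Rightarrow> real" and f :: "real \<Rightarrow> real" and I
    using that by (simp add: has_bochner_integral_iff integrable_distr_eq integral_distr)
  have C1: "gram_schmidt_poly \<beta> lam1 1 = [:- (lam1 * a1), 1:]"
    by (rule gram_schmidt_1[OF marg(1) P.prob_space_distr[OF meas(1)]])
       (rule law[OF meas(1) _ fst_moment], simp)
  have C2: "gram_schmidt_poly \<beta> lam2 2 = [:A * m1 - m2, - A, 1:]"
    unfolding A_def
    unfolding m1_def m2_def m3_def
    by (rule gram_schmidt_2[OF marg(2) P.prob_space_distr[OF meas(2)], unfolded Let_def])
       (rule law[OF meas(2)], simp, rule snd_moments)+
  have pos: "0 < c 1" "0 < c 2"
    using ml_coeff_pos assms(3) by (auto simp: c_def)
  have var: "0 < m2 - m1 ^ 2"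
  proof -
    have "m2 - m1 ^ 2 = lam2 ^ 2 * (2 * c 2 - c 1 ^ 2) + lam2 * c 1"
      by (simp add: m1_def m2_def a1_def a2_def algebra_simps power2_eq_square)
    also have "\<dots> > 0"
      using assms ml_coeff_variance_nonneg[of \<beta>] pos
      by (intro add_nonneg_pos mult_nonneg_nonneg) (auto simp: c_def)
    finally show ?thesis .
  qed
  \<comment> \<open>The integral is the covariance of \<open>x\<^sub>1\<close> with \<open>x\<^sub>2\<^sup>2 - A x\<^sub>2\<close>; the constant term of the second
      polynomial is annihilated because the first one has mean zero.\<close>
  define J where "J = (lam1 * lam2 ^ 2 * a3 + lam1 * lam2 * a2 - lam1 * a1 * m2)
      - A * (lam1 * lam2 * a2 - lam1 * a1 * m1)"
  have "has_bochner_integral P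
      (\<lambda>x. (fst x * snd x ^ 2 - lam1 * a1 * snd x ^ 2) - A * (fst x * snd x - lam1 * a1 * snd x)
          + (A * m1 - m2) * (fst x - lam1 * a1))
      (J + (A * m1 - m2) * (lam1 * a1 - lam1 * a1))"
    unfolding J_def m1_def m2_def
    by (intro has_bochner_integral_add has_bochner_integral_diff has_bochner_integral_mult_right
        fst_moment snd_moments mixed_moments) (simp add: has_bochner_integral_iff P.prob_space)
  then have "(\<integral>(x1, x2). poly (gram_schmidt_poly \<beta> lam1 1) x1 * poly (gram_schmidt_poly \<beta> lam2 2) x2 \<partial>P) = J"
    unfolding C1 C2 case_prod_beta'
    by (simp add: has_bochner_integral_iff algebra_simps power2_eq_square)
  moreover have "J * (m2 - m1 ^ 2) = lam1 * lam2 ^ 3 * (a1 * a3 + a1 ^ 2 * a2 - 2 * a2 ^ 2)"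
    using covariance_algebra[of lam2 a2 a1 lam1 a3] var
    unfolding J_def A_def m1_def m2_def m3_def by simp
  moreover have "a1 * a3 + a1 ^ 2 * a2 - 2 * a2 ^ 2
      = 2 * (3 * (c 1 * c 3) + c 1 ^ 2 * c 2 - 4 * c 2 ^ 2)"
    by (simp add: a1_def a2_def a3_def algebra_simps power2_eq_square)
  moreover have "3 * (c 1 * c 3) + c 1 ^ 2 * c 2 - 4 * c 2 ^ 2 = 0 \<longleftrightarrow> \<beta> = 1"
  proof (cases "\<beta> = 1")
    case True
    have "c n = 1 / fact n" for n
      unfolding c_def ml_coeff_def True by (simp add: Gamma_fact add.commute)
    then show ?thesis
      using True by (simp add: fact_numeral power2_eq_square)
  next
    case False
    then show ?thesis
      using ml_coeff_cubic_ineq[of \<beta>] assms by (simp add: c_def)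
  qed
  ultimately show ?thesis
    using var assms by (smt (verit) mult_eq_0_iff zero_less_power)
qed

end
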